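(* Let $k\ge 2$, let $a_1,\ldots,a_k$ be relatively prime positive integers, let $j\ge 0$ be an integer, and suppose $\gcd(a_2,\ldots,a_k)=d$. Then $$f_j(a_1,a_2,\ldots,a_k)=d\cdot f_j\!\left(a_1,\frac{a_2}{d},\ldots,\frac{a_k}{d}\right).$$
   Context: A positive representation of an integer $M$ by a $k$-tuple $(b_1,\ldots,b_k)$ of positive integers is a solution $(x_1,\ldots,x_k)\in\mathbb{Z}_{>0}^k$ of $M=\sum_{i=1}^k b_ix_i$. For relatively prime positive integers $b_1,\ldots,b_k$ and an integer $j\ge0$, $f_j(b_1,\ldots,b_k)$ is the greatest integer $M$ having exactly $j$ positive representations by $(b_1,\ldots,b_k)$, if such a positive integer exists, and $f_j(b_1,\ldots,b_k)=0$ otherwise. *)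

theory Defs
  imports Complex_Main
begin

definition positive_reps :: "int list \<Rightarrow> int \<Rightarrow> int list set" where
  "positive_reps b M =
     {x. length x = length b \<and> (\<forall>y\<in>set x. 0 < y) \<and> M = (\<Sum>i<length b. b ! i * x ! i)}"

text \<open>Finiteness is required separately because the cardinality of an infinite set is \<open>0\<close>;
  it is automatic when all entries of \<open>b\<close> are positive.\<close>

definition exactly_reps :: "nat \<Rightarrow> int list \<Rightarrow> int \<Rightarrow> bool" where
  "exactly_reps j b M \<longleftrightarrow> finite (positive_reps b M) \<and> card (positive_reps b M) = j"

text \<open>For at least two positive entries with greatest common divisor \<open>1\<close>, the number of positive
  representations of \<open>M\<close> tends to infinity with \<open>M\<close>, so the maximum below exists whenever the
  condition of the conditional holds.\<close>

definition frob_f :: "nat \<Rightarrow> int list \<Rightarrow> int" where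
  "frob_f j b =
     (if \<exists>M>0. exactly_reps j b M then (GREATEST M. exactly_reps j b M) else 0)"

end

theory Submission
  imports Defs
begin

text \<open>Let \<open>d\<close> be the gcd of \<open>a\<^sub>2, \<dots>, a\<^sub>k\<close>. In every representation of \<open>M\<close> the coefficient of \<open>a\<^sub>1\<close>
  lies in one residue class modulo \<open>d\<close>, with least positive member \<open>x\<^sub>0 \<le> d\<close>. Adding
  \<open>d - x\<^sub>0\<close> to that coefficient identifies the representations of \<open>M\<close> with those of
  \<open>M + a\<^sub>1 (d - x\<^sub>0)\<close>, a multiple of \<open>d\<close> that is at least \<open>M\<close>; so the greatest \<open>M\<close> with \<open>j\<close>
  representations is a multiple of \<open>d\<close>. Representations of \<open>d N\<close> by the \<open>a\<^sub>i\<close> have first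
  coefficient divisible by \<open>d\<close>, hence correspond to representations of \<open>N\<close> by the reduced tuple.\<close>

section \<open>Splitting off the first coefficient, and scaling by a common divisor\<close>

lemma positive_reps_Nil: "positive_reps [] M = (if M = 0 then {[]} else {})"
  by (auto simp: positive_reps_def)

lemma Cons_in_positive_reps_iff:
  "x # xs \<in> positive_reps (a # as) M \<longleftrightarrow> 0 < x \<and> xs \<in> positive_reps as (M - a * x)"
  by (auto simp: positive_reps_def sum.lessThan_Suc_shift simp del: sum.lessThan_Suc)

lemma positive_reps_ConsE:
  assumes "r \<in> positive_reps (a # as) M"
  obtains x xs where "r = x # xs" "0 < x" "xs \<in> positive_reps as (M - a * x)"
proof (cases r)
  case Nil
  then show thesis using assms by (simp add: positive_reps_def)
next
  case (Cons x xs)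
  then show thesis using assms that by (simp add: Cons_in_positive_reps_iff)
qed

lemma dvd_of_positive_reps:
  assumes "xs \<in> positive_reps as M" "\<forall>b\<in>set as. d dvd b"
  shows "d dvd M"
  using assms by (auto simp: positive_reps_def intro!: dvd_sum)

lemma positive_reps_map_div:
  assumes "d \<noteq> 0" "\<forall>b\<in>set as. d dvd b"
  shows "positive_reps (map (\<lambda>b. b div d) as) N = positive_reps as (d * N)"
proof -
  have "N = (\<Sum>i<length as. as ! i div d * x ! i) \<longleftrightarrow> d * N = (\<Sum>i<length as. as ! i * x ! i)"
    for x :: "int list"
  proof -
    have "(\<Sum>i<length as. as ! i * x ! i) = d * (\<Sum>i<length as. as ! i div d * x ! i)"
      unfolding sum_distrib_left
      by (rule sum.cong) (use assms in \<open>auto simp flip: mult.assoc\<close>)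
    then show ?thesis
      using assms(1) by simp
  qed
  then show ?thesis
    by (simp add: positive_reps_def)
qed

section \<open>Linear congruences and the representations of large integers\<close>

lemma ex_pos_residue:
  fixes a d M :: int
  assumes "0 < d" "gcd a d dvd M"
  obtains x where "0 < x" "x \<le> d" "d dvd M - a * x"
proof -
  obtain u v where uv: "u * a + v * d = gcd a d"
    using bezout_int by blast
  obtain q where q: "M = gcd a d * q"
    using assms(2) by blast
  \<comment> \<open>Bezout makes \<open>u * q\<close> a solution of the congruence modulo
    \<open>d\<close>. Subtracting 1 before the reduction and adding it back afterwards places the
    residue in 1, ..., \<open>d\<close> instead of 0, ..., \<open>d - 1\<close>, since coefficients
    must be positive.\<close>
  define y where "y = u * q - 1"
  have "M - a * (y mod d + 1) = d * (v * q + a * (y div d))"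
  proof -
    have "y mod d + 1 = u * q - d * (y div d)"
      using minus_mult_div_eq_mod[of y d] by (simp add: y_def)
    moreover have "M = u * a * q + v * d * q" using q uv by (metis distrib_right)
    ultimately show ?thesis by (simp only:) (simp add: algebra_simps)
  qed
  with that[of "y mod d + 1"] assms(1) show thesis
    by (simp add: add_strict_increasing2 add1_zle_eq)
qed

lemma Gcd_pos_of_pos:
  fixes as :: "int list"
  assumes "as \<noteq> []" "\<forall>b\<in>set as. 0 < b"
  shows "0 < Gcd (set as)"
proof -
  have "Gcd (set as) \<noteq> 0" using assms by (cases as) auto
  then show ?thesis by (smt (verit) Gcd_int_greater_eq_0)
qed

text \<open>Induction on the tuple: a suitable first coefficient, at most the gcd of the tail,
  leaves a multiple of that gcd. This lowers \<open>M\<close> by at most \<open>a\<close> times the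
  gcd, so raising the threshold by this amount keeps the remainder in the range of the induction
  hypothesis.\<close>

lemma positive_reps_nonempty_eventually:
  assumes "as \<noteq> []" "\<forall>b\<in>set as. 0 < b"
  shows "\<exists>B. \<forall>M>B. Gcd (set as) dvd M \<longrightarrow> positive_reps as M \<noteq> {}"
  using assms
proof (induction as)
  case (Cons a as)
  show ?case
  proof (cases "as = []")
    case True
    have "positive_reps (a # as) M \<noteq> {}" if M: "M > 0" "Gcd (set (a # as)) dvd M" for M
    proof -
      obtain q where "M = a * q" using M True by auto
      moreover from this have "0 < q" using M Cons.prems by (auto simp: zero_less_mult_iff)
      ultimately have "[q] \<in> positive_reps (a # as) M"
        by (simp add: True Cons_in_positive_reps_iff positive_reps_Nil)
      then show ?thesis by blast
    qed
    then show ?thesis by blast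
  next
    case False
    let ?d = "Gcd (set as)"
    obtain B where B: "\<And>M. M > B \<Longrightarrow> ?d dvd M \<Longrightarrow> positive_reps as M \<noteq> {}"
      using Cons False by auto
    have d: "0 < ?d" using Gcd_pos_of_pos False Cons.prems by simp
    have "positive_reps (a # as) M \<noteq> {}" if M: "M > B + a * ?d" "Gcd (set (a # as)) dvd M" for M
    proof -
      have "gcd a ?d dvd M" using M by simp
      then obtain x where x: "0 < x" "x \<le> ?d" "?d dvd M - a * x"
        using ex_pos_residue d by blast
      have "a * x \<le> a * ?d" using x Cons.prems by simp
      then obtain xs where "xs \<in> positive_reps as (M - a * x)"
        using B[of "M - a * x"] x M by auto
      then have "x # xs \<in> positive_reps (a # as) M"
        using x by (simp add: Cons_in_positive_reps_iff)
      then show ?thesis by blast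
    qed
    then show ?thesis by blast
  qed
qed simp

text \<open>A large \<open>M\<close> has more than \<open>j\<close> representations, because many
  first coefficients in one residue class modulo the gcd of the tail leave a remainder that the tail
  represents. The bound ensures that the \<open>GREATEST\<close> in \<open>frob_f\<close> is
  attained.\<close>

lemma exactly_reps_bounded:
  assumes "as \<noteq> []" "\<forall>b\<in>set (a # as). 0 < b" "Gcd (set (a # as)) = 1"
  shows "\<exists>B. \<forall>M. exactly_reps j (a # as) M \<longrightarrow> M \<le> B"
proof -
  define D where "D = Gcd (set as)"
  obtain B where B: "\<And>M. M > B \<Longrightarrow> D dvd M \<Longrightarrow> positive_reps as M \<noteq> {}"
    using positive_reps_nonempty_eventually[of as] assms unfolding D_def by auto
  have d: "0 < D" using Gcd_pos_of_pos assms by (simp add: D_def)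
  \<comment> \<open>The first coefficients used are \<open>x + D * int t\<close> with
    \<open>t \<le> j\<close> and \<open>x \<le> D\<close>, so none exceeds
    \<open>D + D * int j\<close>.\<close>
  have "\<not> exactly_reps j (a # as) M" if M: "M > B + a * (D + D * int j)" for M
  proof
    assume ex: "exactly_reps j (a # as) M"
    have "gcd a D dvd M" using assms by (simp add: D_def)
    then obtain x where x: "0 < x" "x \<le> D" "D dvd M - a * x"
      using ex_pos_residue d by blast
    have "\<exists>xs. xs \<in> positive_reps as (M - a * (x + D * int t))" if "t \<le> j" for t
    proof -
      have "x + D * int t \<le> D + D * int j"
        using x d that by (intro add_mono mult_left_mono) auto
      then have "a * (x + D * int t) \<le> a * (D + D * int j)"
        using assms(2) by (intro mult_left_mono) auto
      moreover have "D dvd M - a * (x + D * int t)"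
        using dvd_diff[OF x(3), of "D * (a * int t)"] by (simp add: algebra_simps)
      ultimately have "positive_reps as (M - a * (x + D * int t)) \<noteq> {}"
        using M B by auto
      then show ?thesis by blast
    qed
    then obtain f where f: "\<And>t. t \<le> j \<Longrightarrow> f t \<in> positive_reps as (M - a * (x + D * int t))"
      by metis
    let ?g = "\<lambda>t. (x + D * int t) # f t"
    \<comment> \<open>Different \<open>t\<close> give different first coefficients, so there are at
      least \<open>j + 1\<close> representations.\<close>
    have "inj_on ?g {..j}" using d by (auto simp: inj_on_def)
    moreover have "?g ` {..j} \<subseteq> positive_reps (a # as) M"
      using f x d by (auto simp: Cons_in_positive_reps_iff intro!: add_pos_nonneg)
    ultimately have "card {..j} \<le> card (positive_reps (a # as) M)"
      using ex card_inj_on_le unfolding exactly_reps_def by blast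
    then show False using ex by (simp add: exactly_reps_def)
  qed
  then show ?thesis by (meson not_le)
qed

section \<open>Bijections between sets of representations\<close>

lemma exactly_reps_bij_betw:
  assumes "bij_betw f (positive_reps b M) (positive_reps c N)"
  shows "exactly_reps j b M \<longleftrightarrow> exactly_reps j c N"
  using bij_betw_finite[OF assms] bij_betw_same_card[OF assms] by (simp add: exactly_reps_def)

lemma exactly_reps_div_iff:
  assumes d: "0 < d" "\<forall>b\<in>set as. d dvd b" and "coprime a d"
  shows "exactly_reps j (a # map (\<lambda>b. b div d) as) N \<longleftrightarrow> exactly_reps j (a # as) (d * N)"
proof -
  let ?c = "map (\<lambda>b. b div d) as"
  let ?f = "\<lambda>r. d * hd r # tl r" and ?g = "\<lambda>r. (hd r div d) # tl r"
  have scale: "positive_reps ?c (N - a * y) = positive_reps as (d * N - a * (d * y))" for y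
    using positive_reps_map_div[of d as] d by (simp add: algebra_simps)
  \<comment> \<open>\<open>d\<close> divides \<open>d * N\<close> and everything the tail
    represents, hence \<open>a * x\<close>; coprimality passes this on to \<open>x\<close>. This
    makes division of the first coefficient by \<open>d\<close> exact.\<close>
  have fst_mult: "\<exists>y. x = d * y" if "xs \<in> positive_reps as (d * N - a * x)" for x xs
  proof -
    have "d dvd a * x"
      using dvd_diff[OF dvd_triv_left dvd_of_positive_reps[OF that d(2)], of N] by simp
    then show ?thesis using assms(3) by (auto simp: coprime_commute coprime_dvd_mult_right_iff)
  qed
  have "bij_betw ?f (positive_reps (a # ?c) N) (positive_reps (a # as) (d * N))"
  proof (rule bij_betw_byWitness)
    show "\<forall>r\<in>positive_reps (a # ?c) N. ?g (?f r) = r"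
      using d by (auto elim!: positive_reps_ConsE)
    show "\<forall>r\<in>positive_reps (a # as) (d * N). ?f (?g r) = r"
      using d by (auto elim!: positive_reps_ConsE dest!: fst_mult)
    show "?f ` positive_reps (a # ?c) N \<subseteq> positive_reps (a # as) (d * N)"
      using d by (auto elim!: positive_reps_ConsE simp: Cons_in_positive_reps_iff scale)
    show "?g ` positive_reps (a # as) (d * N) \<subseteq> positive_reps (a # ?c) N"
    proof
      fix s assume "s \<in> ?g ` positive_reps (a # as) (d * N)"
      then obtain x xs where s: "s = (x div d) # xs" "0 < x"
        and xs: "xs \<in> positive_reps as (d * N - a * x)"
        by (auto elim!: positive_reps_ConsE)
      from fst_mult[OF xs] obtain y where "x = d * y" by blast
      with s xs d show "s \<in> positive_reps (a # ?c) N"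
        by (simp add: Cons_in_positive_reps_iff scale zero_less_mult_iff)
    qed
  qed
  then show ?thesis by (rule exactly_reps_bij_betw)
qed

lemma exactly_reps_next_multiple:
  assumes d: "0 < d" "\<forall>b\<in>set as. d dvd b" and "coprime a d" "0 < a"
    and ex: "exactly_reps j (a # as) M"
  obtains N where "M \<le> d * N" "exactly_reps j (a # as) (d * N)"
proof -
  obtain x0 where x0: "0 < x0" "x0 \<le> d" "d dvd M - a * x0"
    using ex_pos_residue[of d a M] assms by auto
  define e where "e = d - x0"
  have "d dvd M - a * x0 + a * d" using x0 by (intro dvd_add) auto
  then have "d dvd M + a * e" by (simp add: e_def algebra_simps)
  then obtain N where N: "M + a * e = d * N" by blast
  have e: "0 \<le> e" using x0 by (simp add: e_def)
  let ?f = "\<lambda>r. (hd r + e) # tl r" and ?g = "\<lambda>r. (hd r - e) # tl r"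
  \<comment> \<open>The inverse shift must keep the first coefficient positive. That coefficient is
    a positive multiple of \<open>d\<close>, hence at least \<open>d\<close>, while
    \<open>e < d\<close> because \<open>x0\<close> is positive.\<close>
  have large: "e < x" if "0 < x" "xs \<in> positive_reps as (d * N - a * x)" for x xs
  proof -
    have "d dvd a * x"
      using dvd_diff[OF dvd_triv_left dvd_of_positive_reps[OF that(2) d(2)], of N] by simp
    then have "d dvd x" using assms(3) by (simp add: coprime_commute coprime_dvd_mult_right_iff)
    then have "d \<le> x" using that zdvd_imp_le by blast
    then show ?thesis using x0 by (simp add: e_def)
  qed
  have shift: "M - a * x = d * N - a * (x + e)" for x
    using N by (simp add: algebra_simps)
  have "bij_betw ?f (positive_reps (a # as) M) (positive_reps (a # as) (d * N))"
  proof (rule bij_betw_byWitness)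
    show "\<forall>r\<in>positive_reps (a # as) M. ?g (?f r) = r"
      by (auto elim!: positive_reps_ConsE)
    show "\<forall>r\<in>positive_reps (a # as) (d * N). ?f (?g r) = r"
      by (auto elim!: positive_reps_ConsE)
    show "?f ` positive_reps (a # as) M \<subseteq> positive_reps (a # as) (d * N)"
      using e by (auto elim!: positive_reps_ConsE simp: Cons_in_positive_reps_iff shift)
    show "?g ` positive_reps (a # as) (d * N) \<subseteq> positive_reps (a # as) M"
      using large by (auto elim!: positive_reps_ConsE simp: Cons_in_positive_reps_iff shift)
  qed
  then have "exactly_reps j (a # as) (d * N)" using ex exactly_reps_bij_betw by blast
  moreover have "M \<le> d * N" using N e assms(4) by (smt (verit) mult_nonneg_nonneg)
  ultimately show thesis using that by blast
qed

section \<open>Greatest elements and the comparison of the two values\<close>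

lemma int_bounded_has_greatest:
  fixes P :: "int \<Rightarrow> bool"
  assumes "P m" "\<And>x. P x \<Longrightarrow> x \<le> B"
  obtains n where "P n" "\<And>x. P x \<Longrightarrow> x \<le> n"
proof -
  let ?S = "{x. P x \<and> m \<le> x}"
  \<comment> \<open>Cutting off below the witness \<open>m\<close> leaves a finite set, and whatever
    was cut off is smaller than \<open>m\<close>.\<close>
  have fin: "finite ?S" by (rule finite_subset[of _ "{m..B}"]) (use assms in auto)
  have "Max ?S \<in> ?S" using fin assms(1) by (intro Max_in) auto
  moreover have "x \<le> Max ?S" if "P x" for x
    using that Max_ge[OF fin, of x] Max_ge[OF fin, of m] assms(1) by (cases "m \<le> x") auto
  ultimately show thesis using that by blast
qed

theorem theorem2:
  fixes k j :: nat and a1 d :: int and as :: "int list"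
  assumes "k \<ge> 2"
    and "length (a1 # as) = k"
    and "\<forall>b\<in>set (a1 # as). 0 < b"
    and "Gcd (set (a1 # as)) = 1"
    and "Gcd (set as) = d"
  shows "frob_f j (a1 # as) = d * frob_f j (a1 # map (\<lambda>b. b div d) as)"
proof -
  let ?A = "exactly_reps j (a1 # as)" and ?C = "exactly_reps j (a1 # map (\<lambda>b. b div d) as)"
  have ne: "as \<noteq> []" using assms(1,2) by auto
  have d: "0 < d" using Gcd_pos_of_pos[OF ne] assms by simp
  have dvd: "\<forall>b\<in>set as. d dvd b" using assms(5) by auto
  have cop: "coprime a1 d" using assms(4,5) by (simp add: coprime_iff_gcd_eq_1)
  have a1: "0 < a1" using assms(3) by simp
  have C_iff: "?C N \<longleftrightarrow> ?A (d * N)" for N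
    by (rule exactly_reps_div_iff[OF d dvd cop])
  show ?thesis
  proof (cases "\<exists>M>0. ?A M")
    case True
    then obtain m where m: "0 < m" "?A m" by blast
    obtain B where "\<And>M. ?A M \<Longrightarrow> M \<le> B"
      using exactly_reps_bounded[OF ne assms(3,4)] by blast
    with m(2) obtain n where n: "?A n" "\<And>M. ?A M \<Longrightarrow> M \<le> n"
      using int_bounded_has_greatest[of ?A] by blast
    obtain N where N: "n \<le> d * N" "?A (d * N)"
      using exactly_reps_next_multiple[OF d dvd cop a1 n(1)] by blast
    then have nN: "n = d * N" using n(2) by (simp add: order_antisym)
    \<comment> \<open>Positivity of \<open>N\<close> puts the reduced tuple in the nondefault branch
      of \<open>frob_f\<close> as well.\<close>
    have "0 < d * N" using m n(2)[OF m(2)] nN by simp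
    then have "0 < N" using d by (simp add: zero_less_mult_iff)
    have "?C N" using C_iff N by simp
    have "(GREATEST M. ?A M) = d * N"
      using n nN by (intro Greatest_equality) auto
    moreover have "(GREATEST M. ?C M) = N"
    proof (rule Greatest_equality)
      fix y assume "?C y"
      then have "d * y \<le> d * N" using n(2) nN C_iff by simp
      then show "y \<le> N" using d by simp
    qed (fact \<open>?C N\<close>)
    ultimately show ?thesis
      using True \<open>?C N\<close> \<open>0 < N\<close> by (auto simp: frob_f_def)
  next
    case False
    \<comment> \<open>A positive \<open>N\<close> for the reduced tuple would give the positive
      \<open>d * N\<close> for the original one, so both values are the default 0.\<close>
    then have "\<not> (\<exists>M>0. ?C M)" using C_iff d by simp
    with False show ?thesis by (simp only: frob_f_def if_False mult_zero_right)
  qed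
qed

end
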